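(* Let $\hat{\mathfrak T}$ be a finite partially ordered set with a top element $\mathcal T$, and let $\mathcal F$ be a function space on $\hat{\mathfrak T}$. Assume that for every $F\in\hat{\mathfrak T}$ we have chosen a subspace $\mathring{\mathcal F}(F)^\dagger$ of $\mathcal F(F)^*$ that is mapped isomorphically onto $\mathring{\mathcal F}(F)^*$ by restriction of functionals to $\mathring{\mathcal F}(F)$. Assume that we have a consistent family of extension operators on $\hat{\mathfrak T}$. Then $\mathcal F(\mathcal T)^*$ is the (internal) direct sum $$\mathcal F(\mathcal T)^*=\bigoplus_{F\in\hat{\mathfrak T}}\left(\operatorname{tr}^{\mathcal T}_F\right)^*\mathring{\mathcal F}(F)^\dagger.$$
   Context: All vector spaces are over a fixed field; $V^*$ is the space of linear functionals on $V$, and for a linear map $A\colon V\to W$ the dual map $A^*\colon W^*\to V^*$ is $A^*\alpha=\alpha\circ A$. A function space $\mathcal F$ on a partially ordered set $P$ consists of a vector space $\mathcal F(F)$ for every $F\in P$ and a linear map $\operatorname{tr}^F_K\colon\mathcal F(F)\to\mathcal F(K)$ (trace map) for every relation $K\le F$, such that $\operatorname{tr}^F_F$ is the identity and $\operatorname{tr}^G_K\circ\operatorname{tr}^F_G=\operatorname{tr}^F_K$ whenever $K\le G\le F$. The subspace of vanishing trace is $\mathring{\mathcal F}(F)=\{\phi\in\mathcal F(F)\mid\operatorname{tr}^F_K\phi=0\text{ for all }K<F\}$. A consistent family of extension operators on $P$ is a family of linear maps $E^F_K\colon\mathring{\mathcal F}(K)\to\mathcal F(F)$, one for every $K,F\in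 P$, such that (i) $E^K_K$ is the inclusion $\mathring{\mathcal F}(K)\to\mathcal F(K)$; (ii) $E^F_K=0$ if $K\not\le F$; (iii) $\operatorname{tr}^F_GE^F_K=E^G_K$ whenever $G\le F$. The condition on $\mathring{\mathcal F}(F)^\dagger\subseteq\mathcal F(F)^*$ means explicitly: for every $\alpha\in\mathring{\mathcal F}(F)^*$ there exists $\beta\in\mathring{\mathcal F}(F)^\dagger$ with $\beta(\phi)=\alpha(\phi)$ for all $\phi\in\mathring{\mathcal F}(F)$; and if $\beta\in\mathring{\mathcal F}(F)^\dagger$ satisfies $\beta(\phi)=0$ for all $\phi\in\mathring{\mathcal F}(F)$, then $\beta=0$. $\mathcal F(\mathcal T)$ is just the vector space that the function space assigns to the top element $\mathcal T$ (no further assumption on it). *)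

theory Defs
  imports "Jordan_Normal_Form.Missing_VectorSpace"
begin

definition scalar_space :: "('k, 'r) ring_scheme \<Rightarrow> ('k, 'k) module" where
  "scalar_space K = \<lparr>carrier = carrier K, mult = mult K, one = one K,
     zero = zero K, add = add K, smult = mult K\<rparr>"

text \<open>Functionals are made extensional (\<open>undefined\<close> outside the carrier), so that functionals
  agreeing on the carrier are equal. The addition, zero and scalar multiplication are the
  pointwise ones of the space of all \<open>K\<close>-valued functions on the carrier.\<close>

definition dual_space ::
    "('k, 'r) ring_scheme \<Rightarrow> ('k, 'v, 'm) module_scheme \<Rightarrow> ('k, 'v \<Rightarrow> 'k) module" where
  "dual_space K V = (LinearCombinations.ring.func_space K (carrier V))
     \<lparr>carrier := module_hom K V (scalar_space K) \<inter> extensional (carrier V)\<rparr>"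

definition dual_map ::
    "('k, 'v, 'm) module_scheme \<Rightarrow> ('v \<Rightarrow> 'w) \<Rightarrow> ('w \<Rightarrow> 'k) \<Rightarrow> ('v \<Rightarrow> 'k)" where
  "dual_map V A \<alpha> = (\<lambda>v\<in>carrier V. \<alpha> (A v))"

text \<open>Restriction of functionals to the subspace \<open>U\<close> of \<open>V\<close> maps the subspace \<open>D\<close> of the dual of
  \<open>V\<close> isomorphically onto the dual of \<open>U\<close>: it is surjective and has trivial kernel on \<open>D\<close>.
  See \<open>restricts_isomorphically_iff_bij_betw\<close> below.\<close>

definition restricts_isomorphically ::
    "('k, 'r) ring_scheme \<Rightarrow> ('k, 'v, 'm) module_scheme \<Rightarrow> 'v set \<Rightarrow> ('v \<Rightarrow> 'k) set \<Rightarrow> bool" where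
  "restricts_isomorphically K V U D \<longleftrightarrow>
     (\<forall>\<alpha>\<in>carrier (dual_space K (V\<lparr>carrier := U\<rparr>)). \<exists>\<beta>\<in>D. \<forall>\<phi>\<in>U. \<beta> \<phi> = \<alpha> \<phi>) \<and>
     (\<forall>\<beta>\<in>D. (\<forall>\<phi>\<in>U. \<beta> \<phi> = \<zero>\<^bsub>K\<^esub>) \<longrightarrow> \<beta> = \<zero>\<^bsub>dual_space K V\<^esub>)"

definition internal_direct_sum ::
    "('k, 'r) ring_scheme \<Rightarrow> ('k, 'v, 'm) module_scheme \<Rightarrow> 'i set \<Rightarrow> ('i \<Rightarrow> 'v set) \<Rightarrow> bool" where
  "internal_direct_sum K V I W \<longleftrightarrow>
     vectorspace K V \<and> finite I \<and> (\<forall>i\<in>I. subspace K (W i) V) \<and>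
     (\<forall>v\<in>carrier V. \<exists>!w. w \<in> (\<Pi>\<^sub>E i\<in>I. W i) \<and> v = (\<Oplus>\<^bsub>V\<^esub>i\<in>I. w i))"

text \<open>The poset is a subset \<open>P\<close> of a type with a partial order. The spaces \<open>V F\<close> each carry their
  own operations; using one type \<open>'v\<close> for all of their elements is no restriction, since they may
  be placed disjointly in it. \<open>tr F G\<close> is the trace map from \<open>V F\<close> to \<open>V G\<close>, relevant only
  for \<open>G \<le> F\<close>.\<close>

locale function_space =
  fixes K :: "('k, 'r) ring_scheme"
    and P :: "'p::order set"
    and V :: "'p \<Rightarrow> ('k, 'v, 'm) module_scheme"
    and tr :: "'p \<Rightarrow> 'p \<Rightarrow> 'v \<Rightarrow> 'v"
  assumes field: "field K"
    and vectorspace: "F \<in> P \<Longrightarrow> vectorspace K (V F)"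
    and trace_linear: "F \<in> P \<Longrightarrow> G \<in> P \<Longrightarrow> G \<le> F \<Longrightarrow> linear_map K (V F) (V G) (tr F G)"
    and trace_refl: "F \<in> P \<Longrightarrow> \<phi> \<in> carrier (V F) \<Longrightarrow> tr F F \<phi> = \<phi>"
    and trace_trans: "F \<in> P \<Longrightarrow> G \<in> P \<Longrightarrow> H \<in> P \<Longrightarrow> H \<le> G \<Longrightarrow> G \<le> F \<Longrightarrow>
      \<phi> \<in> carrier (V F) \<Longrightarrow> tr G H (tr F G \<phi>) = tr F H \<phi>"

definition vanishing_trace ::
    "'p::order set \<Rightarrow> ('p \<Rightarrow> ('k, 'v, 'm) module_scheme) \<Rightarrow> ('p \<Rightarrow> 'p \<Rightarrow> 'v \<Rightarrow> 'v) \<Rightarrow> 'p \<Rightarrow> 'v set" where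
  "vanishing_trace P V tr F =
     {\<phi> \<in> carrier (V F). \<forall>G\<in>P. G < F \<longrightarrow> tr F G \<phi> = \<zero>\<^bsub>V G\<^esub>}"

text \<open>\<open>E F G\<close> is the extension operator from the vanishing-trace subspace of \<open>V G\<close> to \<open>V F\<close>.\<close>

locale consistent_extension = function_space K P V tr
  for K :: "('k, 'r) ring_scheme"
    and P :: "'p::order set"
    and V :: "'p \<Rightarrow> ('k, 'v, 'm) module_scheme"
    and tr :: "'p \<Rightarrow> 'p \<Rightarrow> 'v \<Rightarrow> 'v" +
  fixes E :: "'p \<Rightarrow> 'p \<Rightarrow> 'v \<Rightarrow> 'v"
  assumes ext_linear: "F \<in> P \<Longrightarrow> G \<in> P \<Longrightarrow>
      linear_map K ((V G)\<lparr>carrier := vanishing_trace P V tr G\<rparr>) (V F) (E F G)"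
    and ext_refl: "F \<in> P \<Longrightarrow> \<phi> \<in> vanishing_trace P V tr F \<Longrightarrow> E F F \<phi> = \<phi>"
    and ext_zero: "F \<in> P \<Longrightarrow> G \<in> P \<Longrightarrow> \<not> G \<le> F \<Longrightarrow> \<phi> \<in> vanishing_trace P V tr G \<Longrightarrow>
      E F G \<phi> = \<zero>\<^bsub>V F\<^esub>"
    and trace_ext: "F \<in> P \<Longrightarrow> G \<in> P \<Longrightarrow> H \<in> P \<Longrightarrow> G \<le> F \<Longrightarrow> \<phi> \<in> vanishing_trace P V tr H \<Longrightarrow>
      tr F G (E F H \<phi>) = E G H \<phi>"

lemma dual_space_simps [simp]:
  "carrier (dual_space K V) = module_hom K V (scalar_space K) \<inter> extensional (carrier V)"
  "field K \<Longrightarrow> zero (dual_space K V) = (\<lambda>v\<in>carrier V. \<zero>\<^bsub>K\<^esub>)"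
  "field K \<Longrightarrow> add (dual_space K V) \<alpha> \<beta> = (\<lambda>v\<in>carrier V. \<alpha> v \<oplus>\<^bsub>K\<^esub> \<beta> v)"
  "field K \<Longrightarrow> smult (dual_space K V) a \<alpha> = (\<lambda>v\<in>carrier V. a \<otimes>\<^bsub>K\<^esub> \<alpha> v)"
  using LinearCombinations.ring.func_space_def[of K "carrier V"]
  by (auto simp: dual_space_def field_def domain_def cring_def)

lemma scalar_space_simps [simp]:
  "carrier (scalar_space K) = carrier K" "add (scalar_space K) = add K"
  "zero (scalar_space K) = zero K" "smult (scalar_space K) = mult K"
  by (simp_all add: scalar_space_def)

lemma subspace_dual_space:
  assumes "vectorspace K V"
  shows "subspace K (carrier (dual_space K V)) (LinearCombinations.ring.func_space K (carrier V))"
proof -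
  interpret vectorspace K V by fact
  show ?thesis
    unfolding subspace_def
  proof (intro conjI)
    show "vectorspace K (func_space (carrier V))"
      by (simp add: vectorspace_def func_space_is_module field_axioms)
    have mod: "module K (func_space (carrier V))"
      by (rule func_space_is_module)
    have swap: "(a \<oplus>\<^bsub>K\<^esub> b) \<oplus>\<^bsub>K\<^esub> (c \<oplus>\<^bsub>K\<^esub> d) = (a \<oplus>\<^bsub>K\<^esub> c) \<oplus>\<^bsub>K\<^esub> (b \<oplus>\<^bsub>K\<^esub> d)"
      if "a \<in> carrier K" "b \<in> carrier K" "c \<in> carrier K" "d \<in> carrier K" for a b c d
      using that by (simp add: R.a_ac)
    show "LinearCombinations.submodule K (carrier (dual_space K V)) (func_space (carrier V))"
      unfolding LinearCombinations.submodule_def using mod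
      by (auto simp: func_space_def module_hom_def Pi_def R.r_distr R.m_lcomm
          PiE_def extensional_def swap)
  qed
qed

lemma vectorspace_dual_space:
  assumes "vectorspace K V"
  shows "vectorspace K (dual_space K V)"
proof -
  interpret vectorspace K V by fact
  interpret D: vectorspace K "func_space (carrier V)"
    by (simp add: vectorspace_def func_space_is_module field_axioms)
  show ?thesis
    using D.subspace_is_vs[OF subspace_dual_space[OF assms]]
    by (simp add: dual_space_def)
qed

lemma (in function_space) subspace_vanishing_trace:
  assumes "F \<in> P"
  shows "subspace K (vanishing_trace P V tr F) (V F)"
proof -
  interpret VF: vectorspace K "V F" using assms by (rule vectorspace)
  have lin: "linear_map K (V F) (V G) (tr F G)" if "G \<in> P" "G < F" for G
    using trace_linear[OF assms that(1)] that by auto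
  have tr: "tr F G \<in> module_hom K (V F) (V G)" if "G \<in> P" "G < F" for G
    using lin[OF that] by (simp add: linear_map_def mod_hom_def mod_hom_axioms_def)
  have tr0: "tr F G \<zero>\<^bsub>V F\<^esub> = \<zero>\<^bsub>V G\<^esub>" if "G \<in> P" "G < F" for G
    using lin[OF that] by (auto simp: linear_map_def intro: mod_hom.f0_is_0)
  have mod: "module K (V G)" if "G \<in> P" for G
    using vectorspace[OF that] by (simp add: vectorspace_def)
  have zz: "\<zero>\<^bsub>V G\<^esub> \<oplus>\<^bsub>V G\<^esub> \<zero>\<^bsub>V G\<^esub> = \<zero>\<^bsub>V G\<^esub>" if "G \<in> P" for G
    using mod[OF that] by (simp add: module_def abelian_group_def abelian_monoid.l_zero
        abelian_monoid.zero_closed)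
  have cz: "c \<odot>\<^bsub>V G\<^esub> \<zero>\<^bsub>V G\<^esub> = \<zero>\<^bsub>V G\<^esub>" if "G \<in> P" "c \<in> carrier K" for G c
    using mod[OF that(1)] that(2) by (rule module.smult_r_null)
  show ?thesis
    unfolding subspace_def LinearCombinations.submodule_def vanishing_trace_def
    using VF.vectorspace_axioms VF.module_axioms tr tr0 zz cz
    by (auto simp: module_hom_def)
qed

lemma restricts_isomorphically_iff_bij_betw:
  assumes "subspace K U V" "subspace K D (dual_space K V)"
  shows "restricts_isomorphically K V U D \<longleftrightarrow>
    bij_betw (\<lambda>\<beta>. restrict \<beta> U) D (carrier (dual_space K (V\<lparr>carrier := U\<rparr>)))"
proof -
  let ?r = "\<lambda>\<beta>. restrict \<beta> U" and ?U = "V\<lparr>carrier := U\<rparr>"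
  interpret vectorspace K V using assms(1) by (simp add: subspace_def)
  have UV: "U \<subseteq> carrier V"
    and Uadd: "\<And>x y. x \<in> U \<Longrightarrow> y \<in> U \<Longrightarrow> x \<oplus>\<^bsub>V\<^esub> y \<in> U"
    and Usmult: "\<And>c x. c \<in> carrier K \<Longrightarrow> x \<in> U \<Longrightarrow> c \<odot>\<^bsub>V\<^esub> x \<in> U"
    using assms(1) by (auto simp: subspace_def LinearCombinations.submodule_def)
  have D: "\<And>\<beta>. \<beta> \<in> D \<Longrightarrow> \<beta> \<in> carrier (dual_space K V)"
    and Dadd: "\<And>\<beta> \<gamma>. \<beta> \<in> D \<Longrightarrow> \<gamma> \<in> D \<Longrightarrow> \<beta> \<oplus>\<^bsub>dual_space K V\<^esub> \<gamma> \<in> D"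
    and Dzero: "\<zero>\<^bsub>dual_space K V\<^esub> \<in> D"
    and Dsmult: "\<And>c \<beta>. c \<in> carrier K \<Longrightarrow> \<beta> \<in> D \<Longrightarrow> c \<odot>\<^bsub>dual_space K V\<^esub> \<beta> \<in> D"
    using assms(2) unfolding subspace_def LinearCombinations.submodule_def by blast+
  have Dc: "\<beta> v \<in> carrier K" if "\<beta> \<in> D" "v \<in> carrier V" for \<beta> v
    using D[OF that(1)] that(2) by (auto simp: module_hom_def)
  have Dext: "\<beta> \<in> extensional (carrier V)" if "\<beta> \<in> D" for \<beta>
    using D[OF that] by simp
  have into: "?r \<beta> \<in> carrier (dual_space K ?U)" if "\<beta> \<in> D" for \<beta>
    using D[OF that] UV Uadd Usmult by (auto simp: module_hom_def Pi_def subset_iff)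
  have inj: "inj_on ?r D" if ker: "\<forall>\<beta>\<in>D. (\<forall>\<phi>\<in>U. \<beta> \<phi> = \<zero>\<^bsub>K\<^esub>) \<longrightarrow> \<beta> = \<zero>\<^bsub>dual_space K V\<^esub>"
  proof (rule inj_onI)
    fix \<beta> \<gamma> assume b: "\<beta> \<in> D" and c: "\<gamma> \<in> D" and eq: "?r \<beta> = ?r \<gamma>"
    define \<delta> where "\<delta> = \<beta> \<oplus>\<^bsub>dual_space K V\<^esub> (\<ominus>\<^bsub>K\<^esub> \<one>\<^bsub>K\<^esub>) \<odot>\<^bsub>dual_space K V\<^esub> \<gamma>"
    have "\<delta> \<in> D" unfolding \<delta>_def by (intro Dadd Dsmult b c) simp
    have val: "\<delta> v = \<beta> v \<ominus>\<^bsub>K\<^esub> \<gamma> v" if "v \<in> carrier V" for v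
      using that Dc[OF c that] by (simp add: \<delta>_def field_axioms R.l_minus a_minus_def)
    have "\<delta> \<phi> = \<zero>\<^bsub>K\<^esub>" if "\<phi> \<in> U" for \<phi>
    proof -
      have "\<phi> \<in> carrier V" using that UV by auto
      moreover have "\<beta> \<phi> = \<gamma> \<phi>" using fun_cong[OF eq, of \<phi>] that by simp
      ultimately show ?thesis using Dc[OF c] by (simp add: val a_minus_def R.r_neg)
    qed
    then have d0: "\<delta> = \<zero>\<^bsub>dual_space K V\<^esub>" using ker \<open>\<delta> \<in> D\<close> by blast
    show "\<beta> = \<gamma>"
    proof (rule extensionalityI[OF Dext[OF b] Dext[OF c]])
      fix v assume v: "v \<in> carrier V"
      then have "\<beta> v \<ominus>\<^bsub>K\<^esub> \<gamma> v = \<zero>\<^bsub>K\<^esub>" using val[OF v] d0 by (simp add: field_axioms)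
      then show "\<beta> v = \<gamma> v" using Dc[OF b v] Dc[OF c v] by (metis R.minus_equality R.minus_minus R.a_inv_closed a_minus_def)
    qed
  qed
  have ker: "\<beta> = \<zero>\<^bsub>dual_space K V\<^esub>"
    if "inj_on ?r D" "\<beta> \<in> D" "\<forall>\<phi>\<in>U. \<beta> \<phi> = \<zero>\<^bsub>K\<^esub>" for \<beta>
  proof (rule inj_onD[OF that(1) _ that(2) Dzero])
    show "?r \<beta> = ?r \<zero>\<^bsub>dual_space K V\<^esub>"
      using that(3) UV by (auto simp: restrict_def fun_eq_iff field_axioms)
  qed
  have surj: "?r ` D = carrier (dual_space K ?U) \<longleftrightarrow>
      (\<forall>\<alpha>\<in>carrier (dual_space K ?U). \<exists>\<beta>\<in>D. \<forall>\<phi>\<in>U. \<beta> \<phi> = \<alpha> \<phi>)"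
  proof
    assume L: "?r ` D = carrier (dual_space K ?U)"
    show "\<forall>\<alpha>\<in>carrier (dual_space K ?U). \<exists>\<beta>\<in>D. \<forall>\<phi>\<in>U. \<beta> \<phi> = \<alpha> \<phi>"
      unfolding L[symmetric] by auto
  next
    assume R: "\<forall>\<alpha>\<in>carrier (dual_space K ?U). \<exists>\<beta>\<in>D. \<forall>\<phi>\<in>U. \<beta> \<phi> = \<alpha> \<phi>"
    show "?r ` D = carrier (dual_space K ?U)"
    proof
      show "?r ` D \<subseteq> carrier (dual_space K ?U)" using into by blast
      show "carrier (dual_space K ?U) \<subseteq> ?r ` D"
      proof
        fix \<alpha> assume a: "\<alpha> \<in> carrier (dual_space K ?U)"
        then obtain \<beta> where b: "\<beta> \<in> D" "\<forall>\<phi>\<in>U. \<beta> \<phi> = \<alpha> \<phi>" using R by blast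
        have "\<alpha> \<in> extensional U" using a by simp
        then have "?r \<beta> = \<alpha>" using b(2) by (auto simp: fun_eq_iff extensional_def)
        then show "\<alpha> \<in> ?r ` D" using b(1) by blast
      qed
    qed
  qed
  show ?thesis
    unfolding restricts_isomorphically_def bij_betw_def using surj inj ker by blast
qed

end

theory Submission
  imports Defs
begin

text \<open>
  The extension operators are triangular with respect to the order of \<open>P\<close>. Write \<open>U G\<close> for the
  vanishing-trace subspace at \<open>G\<close>, and let \<open>\<phi> \<in> U G\<close>. The pullback of a functional \<open>\<beta>\<close> on \<open>V F\<close>
  along the trace takes at \<open>E \<T> G \<phi>\<close> the value \<open>\<beta> (E F G \<phi>)\<close>. This is \<open>0\<close> unless \<open>G \<le> F\<close>, and it
  is \<open>\<beta> \<phi>\<close> if \<open>F = G\<close>. Since \<open>D G\<close> is isomorphic to the dual of \<open>U G\<close> under restriction, the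
  diagonal blocks of the pairing of the summands with the extended subspaces are bijective, and so
  the pairing can be solved by substitution from the top of \<open>P\<close> downwards.

  Independence (\<open>dual_trace_images_independent\<close>): if a sum of pullbacks is zero and \<open>G\<close> is maximal
  among the indices of the nonzero summands, then evaluating the sum on extensions from \<open>G\<close> isolates
  the restriction to \<open>U G\<close> of a functional in \<open>D G\<close>; so that functional is zero.

  Spanning (\<open>dual_trace_images_span\<close>): given a functional on \<open>V \<T>\<close>, visit the elements \<open>G\<close> of \<open>P\<close>
  from the top downwards and subtract the pullback of the element of \<open>D G\<close> that agrees on \<open>U G\<close>
  with the current remainder composed with \<open>E \<T> G\<close>. By triangularity a subtraction does not
  disturb what was achieved for the elements visited before. In the end the remainder vanishes on
  all extensions.

  Such a remainder is zero (\<open>functional_eq_zero_if_vanishes_on_extensions\<close>) because the extensions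
  span \<open>V \<T>\<close>: visiting \<open>P\<close> from the bottom upwards, one subtracts from a vector extensions
  of its traces until all traces are zero, and the trace on \<open>\<T>\<close> is the vector itself.
\<close>

section \<open>Induction along a finite order\<close>

text \<open>With \<open>R\<close> as the strict order this visits a finite poset from the bottom upwards, with the
  converse from the top downwards; both directions are used. The last premise of the induction step
  is a consequence of \<open>A\<close> being closed under predecessors, and it is what triangularity of the
  extension operators needs.\<close>

lemma finite_closed_set_induct [consumes 3, case_names empty insert]:
  assumes "finite P" "asymp_on P R" "transp_on P R"
    and empty: "Q {}"
    and insert: "\<And>A x. A \<subseteq> P \<Longrightarrow> x \<in> P - A \<Longrightarrow> (\<And>y. y \<in> P \<Longrightarrow> R y x \<Longrightarrow> y \<in> A) \<Longrightarrow>
      (\<And>y. y \<in> A \<Longrightarrow> \<not> R x y) \<Longrightarrow> Q A \<Longrightarrow> Q (insert x A)"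
  shows "Q P"
proof -
  have "Q A" if "finite A" "A \<subseteq> P" "\<And>x y. x \<in> A \<Longrightarrow> y \<in> P \<Longrightarrow> R y x \<Longrightarrow> y \<in> A" for A
    using that
  proof (induction A rule: finite_psubset_induct)
    case (psubset A)
    show ?case
    proof (cases "A = {}")
      case True
      then show ?thesis using empty by simp
    next
      case False
      have "asymp_on A R" "transp_on A R"
        using assms(2,3) psubset.prems(1) by (auto intro: asymp_on_subset transp_on_subset)
      then obtain m where m: "m \<in> A" "\<And>x. x \<in> A \<Longrightarrow> x \<noteq> m \<Longrightarrow> \<not> R m x"
        using Finite_Set.bex_max_element[OF psubset.hyps(1)] False by blast
      have irr: "\<not> R x x" if "x \<in> P" for x
        using assms(2) that by (auto dest: asymp_onD)
      have "Q (insert m (A - {m}))"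
      proof (rule insert)
        show "Q (A - {m})"
        proof (rule psubset.IH)
          fix x y assume "x \<in> A - {m}" "y \<in> P" "R y x"
          then show "y \<in> A - {m}" using psubset.prems(2)[of x y] m(2)[of x] by auto
        qed (use m psubset.prems(1) in auto)
        fix y assume "y \<in> P" "R y m"
        then show "y \<in> A - {m}" using psubset.prems(2)[of m y] m(1) irr by auto
      qed (use m psubset.prems(1) in auto)
      then show ?thesis using m(1) by (simp add: insert_absorb)
    qed
  qed
  then show ?thesis using assms(1) by blast
qed

section \<open>Dual spaces and dual maps\<close>

lemma dual_spaceD:
  assumes "\<alpha> \<in> carrier (dual_space K V)"
  shows "\<alpha> \<in> extensional (carrier V)"
    and "v \<in> carrier V \<Longrightarrow> \<alpha> v \<in> carrier K"
  using assms by (auto simp: module_hom_def)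

text \<open>This makes the facts about linear maps (values at zero and at differences) available for
  functionals.\<close>

lemma linear_map_functional:
  assumes "vectorspace K V" "\<alpha> \<in> carrier (dual_space K V)"
  shows "linear_map K V (scalar_space K) \<alpha>"
proof -
  interpret vectorspace K V by fact
  have "module K (scalar_space K)"
  proof (rule module_criteria)
    show "\<forall>a\<in>carrier (scalar_space K). \<exists>b\<in>carrier (scalar_space K).
        a \<oplus>\<^bsub>scalar_space K\<^esub> b = \<zero>\<^bsub>scalar_space K\<^esub>"
      using R.r_neg by (auto intro: bexI[of _ "\<ominus>\<^bsub>K\<^esub> _"])
  qed (simp_all add: R.is_cring R.l_distr R.r_distr R.m_assoc R.a_ac)
  then show ?thesis
    using assms
    by (auto simp: linear_map_def mod_hom_def mod_hom_axioms_def vectorspace_def)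
qed

lemma functional_zero:
  assumes "vectorspace K V" "\<alpha> \<in> carrier (dual_space K V)"
  shows "\<alpha> \<zero>\<^bsub>V\<^esub> = \<zero>\<^bsub>K\<^esub>"
  using linear_map.T0_is_0[OF linear_map_functional[OF assms]] by simp

lemma dual_space_finsum_apply:
  assumes "vectorspace K V" "w \<in> I \<rightarrow> carrier (dual_space K V)" "v \<in> carrier V" "finite I"
  shows "(\<Oplus>\<^bsub>dual_space K V\<^esub>i\<in>I. w i) v = (\<Oplus>\<^bsub>K\<^esub>i\<in>I. w i v)"
proof -
  interpret vectorspace K V by fact
  interpret X: vectorspace K "dual_space K V"
    using assms(1) by (rule vectorspace_dual_space)
  show ?thesis
    using assms(4,2)
  proof (induction I)
    case empty
    then show ?case using assms(3) by (simp add: field_axioms)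
  next
    case (insert i I)
    then have w: "w i \<in> carrier (dual_space K V)" "w \<in> I \<rightarrow> carrier (dual_space K V)"
      by auto
    then have "w j v \<in> carrier K" if "j \<in> insert i I" for j
      using that dual_spaceD(2)[OF _ assms(3)] by blast
    then show ?case
      using insert w assms(3)
      by (simp add: X.M.finsum_insert R.finsum_insert field_axioms Pi_iff del: dual_space_simps(1))
  qed
qed

lemma linear_map_dual_map:
  assumes "linear_map K V W A"
  shows "linear_map K (dual_space K W) (dual_space K V) (dual_map V A)"
proof -
  interpret linear_map K V W A by fact
  have hom: "A v \<in> carrier W" "A (v \<oplus>\<^bsub>V\<^esub> v') = A v \<oplus>\<^bsub>W\<^esub> A v'" "A (c \<odot>\<^bsub>V\<^esub> v) = c \<odot>\<^bsub>W\<^esub> A v"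
    if "v \<in> carrier V" "v' \<in> carrier V" "c \<in> carrier K" for v v' c
    using that by auto
  have K: "field K" using assms by (simp add: linear_map_def vectorspace_def)
  have "dual_map V A \<in> module_hom K (dual_space K W) (dual_space K V)"
    using hom by (auto simp: module_hom_def dual_map_def K fun_eq_iff)
  then show ?thesis
    using vectorspace_dual_space[OF V.vectorspace_axioms] vectorspace_dual_space[OF W.vectorspace_axioms]
    by (simp add: linear_map_def mod_hom_def mod_hom_axioms_def vectorspace_def)
qed

lemma subspace_linear_image:
  assumes "linear_map K V W A" "subspace K U V"
  shows "subspace K (A ` U) W"
proof -
  interpret linear_map K V W A by fact
  interpret U: submodule K U V using assms(2) by (simp add: subspace_def)
  have "submodule K (A ` U) W"
  proof (rule submodule.intro)
    show "module K W" using assms(1) by (simp add: linear_map_def vectorspace_def)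
    show "A ` U \<subseteq> carrier W" using U.subset by auto
    show "\<zero>\<^bsub>W\<^esub> \<in> A ` U" using U.zero_closed T0_is_0 by (metis imageI)
  next
    fix x y assume "x \<in> A ` U" "y \<in> A ` U"
    then obtain u v where "u \<in> U" "v \<in> U" "x = A u" "y = A v" by blast
    moreover from this have "A (u \<oplus>\<^bsub>V\<^esub> v) = A u \<oplus>\<^bsub>W\<^esub> A v" using U.subset by (intro T_add) auto
    ultimately show "x \<oplus>\<^bsub>W\<^esub> y \<in> A ` U"
      using U.m_closed[of u v] by (metis imageI)
  next
    fix c x assume "c \<in> carrier K" "x \<in> A ` U"
    then obtain u where "u \<in> U" "x = A u" by blast
    moreover from this have "A (c \<odot>\<^bsub>V\<^esub> u) = c \<odot>\<^bsub>W\<^esub> A u"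
      using \<open>c \<in> carrier K\<close> U.subset by (intro T_smult) auto
    ultimately show "c \<odot>\<^bsub>W\<^esub> x \<in> A ` U"
      using \<open>c \<in> carrier K\<close> U.smult_closed[of c u] by (metis imageI)
  qed
  then show ?thesis by (simp add: subspace_def W.vectorspace_axioms)
qed

section \<open>A criterion for internal direct sums\<close>

text \<open>Two representations of the same vector differ by a representation of zero, because the
  summands are closed under subtraction. The independence hypothesis is stated for families that
  need not be extensional, so that it applies to the pointwise difference directly.\<close>

lemma internal_direct_sumI:
  assumes "vectorspace K X" "finite I" "\<And>i. i \<in> I \<Longrightarrow> subspace K (W i) X"
    and span: "\<And>v. v \<in> carrier X \<Longrightarrow> \<exists>w \<in> \<Pi>\<^sub>E i\<in>I. W i. v = (\<Oplus>\<^bsub>X\<^esub>i\<in>I. w i)"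
    and indep: "\<And>w i. w \<in> (\<Pi> i\<in>I. W i) \<Longrightarrow> (\<Oplus>\<^bsub>X\<^esub>i\<in>I. w i) = \<zero>\<^bsub>X\<^esub> \<Longrightarrow> i \<in> I \<Longrightarrow> w i = \<zero>\<^bsub>X\<^esub>"
  shows "internal_direct_sum K X I W"
proof -
  interpret X: vectorspace K X by fact
  have sub: "submodule K (W i) X" if "i \<in> I" for i
    using assms(3)[OF that] by (simp add: subspace_def)
  have WX: "x \<in> carrier X" if "i \<in> I" "x \<in> W i" for i x
    using submodule.subset[OF sub[OF that(1)]] that(2) by blast
  have diff: "x \<ominus>\<^bsub>X\<^esub> y \<in> W i" if "i \<in> I" "x \<in> W i" "y \<in> W i" for i x y
  proof -
    have "(\<ominus>\<^bsub>K\<^esub> \<one>\<^bsub>K\<^esub>) \<odot>\<^bsub>X\<^esub> y \<in> W i"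
      using submodule.smult_closed[OF sub[OF that(1)] _ that(3)] by simp
    then show ?thesis
      using submodule.m_closed[OF sub[OF that(1)] that(2)] WX[OF that(1,3)]
      by (simp add: a_minus_def X.smult_minus_1)
  qed
  have unique: "w = w'"
    if w: "w \<in> (\<Pi>\<^sub>E i\<in>I. W i)" and w': "w' \<in> (\<Pi>\<^sub>E i\<in>I. W i)"
      and eq: "(\<Oplus>\<^bsub>X\<^esub>i\<in>I. w i) = (\<Oplus>\<^bsub>X\<^esub>i\<in>I. w' i)" for w w'
  proof (rule PiE_ext[OF w w'])
    fix i assume i: "i \<in> I"
    have c: "w \<in> I \<rightarrow> carrier X" "w' \<in> I \<rightarrow> carrier X"
      using w w' WX by (auto simp: PiE_iff)
    have d: "(\<lambda>i. w i \<ominus>\<^bsub>X\<^esub> w' i) \<in> (\<Pi> i\<in>I. W i)"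
      using w w' diff by (auto simp: PiE_iff)
    have d': "(\<lambda>i. w i \<ominus>\<^bsub>X\<^esub> w' i) \<in> I \<rightarrow> carrier X"
      using c by (auto simp: Pi_iff)
    have "(\<Oplus>\<^bsub>X\<^esub>i\<in>I. w i) = (\<Oplus>\<^bsub>X\<^esub>i\<in>I. (w i \<ominus>\<^bsub>X\<^esub> w' i) \<oplus>\<^bsub>X\<^esub> w' i)"
      using c by (intro X.M.finsum_cong')
        (auto simp: Pi_iff a_minus_def X.M.a_assoc X.M.l_neg)
    also have "\<dots> = (\<Oplus>\<^bsub>X\<^esub>i\<in>I. w i \<ominus>\<^bsub>X\<^esub> w' i) \<oplus>\<^bsub>X\<^esub> (\<Oplus>\<^bsub>X\<^esub>i\<in>I. w' i)"
      by (rule X.M.finsum_addf[OF d' c(2)])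
    finally have "(\<Oplus>\<^bsub>X\<^esub>i\<in>I. w i \<ominus>\<^bsub>X\<^esub> w' i) = \<zero>\<^bsub>X\<^esub>"
      using eq X.M.finsum_closed[OF d'] X.M.finsum_closed[OF c(2)]
      by (simp add: X.M.add.r_cancel_one')
    then have "w i \<ominus>\<^bsub>X\<^esub> w' i = \<zero>\<^bsub>X\<^esub>" using indep[OF d _ i] by simp
    moreover have "w i \<in> carrier X" "w' i \<in> carrier X" using c i by auto
    ultimately show "w i = w' i"
      using X.M.minus_equality[of "w i" "\<ominus>\<^bsub>X\<^esub> w' i"] by (simp add: a_minus_def)
  qed
  show ?thesis
    unfolding internal_direct_sum_def using assms(1-3) span unique by (auto intro: ex_ex1I)
qed

section \<open>Functionals on a space with consistent extension operators\<close>

context consistent_extension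
begin

abbreviation "U \<equiv> vanishing_trace P V tr"

lemma ext_closed:
  assumes "F \<in> P" "G \<in> P" "\<phi> \<in> U G"
  shows "E F G \<phi> \<in> carrier (V F)"
  using linear_map.T_im[OF ext_linear[OF assms(1,2)]] assms(3) by simp

text \<open>The triangularity on which everything rests: the right-hand side is \<open>\<beta> \<phi>\<close> for
  \<open>G = H\<close>, and \<open>\<beta>\<close> at zero unless \<open>H \<le> G\<close>.\<close>

lemma dual_trace_apply_ext:
  assumes "F \<in> P" "G \<in> P" "H \<in> P" "G \<le> F" "\<phi> \<in> U H"
  shows "dual_map (V F) (tr F G) \<beta> (E F H \<phi>) = \<beta> (E G H \<phi>)"
  using assms by (simp add: dual_map_def ext_closed trace_ext)

text \<open>The extensions span \<open>V \<T>\<close>. Instead of writing a vector \<open>v\<close> as a sum of extensions, the proof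
  changes \<open>v\<close> by extensions, which does not change the value of \<open>\<gamma>\<close>, and makes more and more
  of its traces zero. Once the traces on everything below \<open>G\<close> are zero, the trace on \<open>G\<close> lies in
  \<open>U G\<close> and has an extension to subtract.\<close>

lemma functional_eq_zero_if_vanishes_on_extensions:
  assumes "finite P" "\<T> \<in> P" "\<And>F. F \<in> P \<Longrightarrow> F \<le> \<T>"
    and \<gamma>: "\<gamma> \<in> carrier (dual_space K (V \<T>))"
    and van: "\<And>G \<phi>. G \<in> P \<Longrightarrow> \<phi> \<in> U G \<Longrightarrow> \<gamma> (E \<T> G \<phi>) = \<zero>\<^bsub>K\<^esub>"
  shows "\<gamma> = \<zero>\<^bsub>dual_space K (V \<T>)\<^esub>"
proof -
  interpret VT: vectorspace K "V \<T>" using vectorspace assms(2) .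
  have "\<gamma> v = \<zero>\<^bsub>K\<^esub>" if v: "v \<in> carrier (V \<T>)" for v
  proof -
    have as: "asymp_on P (<)" "transp_on P (<)"
      by (auto intro: asymp_onI transp_onI)
    define Q where "Q A \<longleftrightarrow>
      (\<exists>v'\<in>carrier (V \<T>). \<gamma> v' = \<gamma> v \<and> (\<forall>F\<in>A. tr \<T> F v' = \<zero>\<^bsub>V F\<^esub>))" for A
    have "Q P"
      using assms(1) as
    proof (induction rule: finite_closed_set_induct)
      case empty
      show ?case using v by (auto simp: Q_def)
    next
      case (insert A G)
      then obtain v' where v': "v' \<in> carrier (V \<T>)" "\<gamma> v' = \<gamma> v"
        and tr0: "\<And>F. F \<in> A \<Longrightarrow> tr \<T> F v' = \<zero>\<^bsub>V F\<^esub>"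
        unfolding Q_def by blast
      from insert.hyps(2) have G: "G \<in> P" "G \<le> \<T>" using assms(3) by auto
      interpret VG: vectorspace K "V G" using vectorspace G(1) .
      interpret trG: linear_map K "V \<T>" "V G" "tr \<T> G"
        using trace_linear assms(2) G by blast
      define \<phi> where "\<phi> = tr \<T> G v'"
      have "tr G H \<phi> = \<zero>\<^bsub>V H\<^esub>" if "H \<in> P" "H < G" for H
        using trace_trans[of \<T> G H v'] tr0[of H] insert.hyps(3)[of H] that assms(2) G v'(1)
        by (auto simp: \<phi>_def)
      then have \<phi>: "\<phi> \<in> U G"
        using v'(1) by (auto simp: vanishing_trace_def \<phi>_def)
      define v'' where "v'' = v' \<ominus>\<^bsub>V \<T>\<^esub> E \<T> G \<phi>"
      have e: "E \<T> G \<phi> \<in> carrier (V \<T>)" using ext_closed assms(2) G \<phi> by blast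
      interpret \<gamma>: linear_map K "V \<T>" "scalar_space K" \<gamma>
        using linear_map_functional VT.vectorspace_axioms \<gamma> .
      have "\<gamma> v'' = \<gamma> v' \<ominus>\<^bsub>scalar_space K\<^esub> \<zero>\<^bsub>scalar_space K\<^esub>"
        using \<gamma>.T_minus[OF v'(1) e] van[OF G(1) \<phi>] by (simp add: v''_def)
      also have "\<dots> = \<gamma> v'"
        using \<gamma>.T_im[OF v'(1)] by (simp add: a_minus_def del: scalar_space_simps)
      finally have "\<gamma> v'' = \<gamma> v" using v'(2) by simp
      \<comment> \<open>At \<open>G\<close> the trace is cancelled; at the elements visited before, none of which is above \<open>G\<close>,
        the subtracted extension has trace zero.\<close>
      moreover have "tr \<T> F v'' = \<zero>\<^bsub>V F\<^esub>" if F: "F \<in> insert G A" for F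
      proof -
        have FP: "F \<in> P" "F \<le> \<T>" using F insert.hyps(1) G assms(3) by auto
        interpret trF: linear_map K "V \<T>" "V F" "tr \<T> F"
          using trace_linear assms(2) FP by blast
        have "tr \<T> F v'' = tr \<T> F v' \<ominus>\<^bsub>V F\<^esub> E F G \<phi>"
          using v'(1) e trace_ext[OF assms(2) FP(1) G(1) FP(2) \<phi>] by (simp add: v''_def)
        also have "\<dots> = \<zero>\<^bsub>V F\<^esub>"
        proof (cases "F = G")
          case True
          then show ?thesis
            using ext_refl[OF G(1) \<phi>] trG.T_im[OF v'(1)] by (simp add: \<phi>_def a_minus_def VG.M.r_neg)
        next
          case False
          then have "F \<in> A" using F by simp
          moreover have "\<not> G \<le> F" using insert.hyps(4)[OF \<open>F \<in> A\<close>] False by auto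
          ultimately show ?thesis
            using ext_zero[OF FP(1) G(1) _ \<phi>] tr0 by (simp add: a_minus_def)
        qed
        finally show ?thesis .
      qed
      moreover have "v'' \<in> carrier (V \<T>)" using v'(1) e by (simp add: v''_def)
      ultimately show ?case unfolding Q_def by blast
    qed
    then obtain v' where "v' \<in> carrier (V \<T>)" "\<gamma> v' = \<gamma> v" "v' = \<zero>\<^bsub>V \<T>\<^esub>"
      using assms(2) trace_refl unfolding Q_def by fastforce
    then show ?thesis using functional_zero[OF VT.vectorspace_axioms \<gamma>] by simp
  qed
  then show ?thesis
    using dual_spaceD(1)[OF \<gamma>] field by (auto intro!: extensionalityI[of _ "carrier (V \<T>)"])
qed

section \<open>Decomposition of the dual space\<close>

text \<open>Of a zero sum, evaluated at an extension from a maximal index \<open>G\<close> of a nonzero summand, only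
  the summand at \<open>G\<close> remains: the indices above \<open>G\<close> contribute nothing by maximality, and the other
  indices nothing by triangularity.\<close>

lemma dual_trace_images_independent:
  assumes fin: "finite P" and top: "\<T> \<in> P" "\<And>F. F \<in> P \<Longrightarrow> F \<le> \<T>"
    and D: "\<And>F. F \<in> P \<Longrightarrow> D F \<subseteq> carrier (dual_space K (V F))"
    and inj: "\<And>F \<beta>. F \<in> P \<Longrightarrow> \<beta> \<in> D F \<Longrightarrow> (\<And>\<phi>. \<phi> \<in> U F \<Longrightarrow> \<beta> \<phi> = \<zero>\<^bsub>K\<^esub>) \<Longrightarrow>
      \<beta> = \<zero>\<^bsub>dual_space K (V F)\<^esub>"
    and w: "w \<in> (\<Pi> F\<in>P. dual_map (V \<T>) (tr \<T> F) ` D F)"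
    and sum0: "(\<Oplus>\<^bsub>dual_space K (V \<T>)\<^esub>F\<in>P. w F) = \<zero>\<^bsub>dual_space K (V \<T>)\<^esub>"
    and "F \<in> P"
  shows "w F = \<zero>\<^bsub>dual_space K (V \<T>)\<^esub>"
proof (rule ccontr)
  let ?Z = "\<zero>\<^bsub>dual_space K (V \<T>)\<^esub>"
  assume "w F \<noteq> ?Z"
  interpret VT: vectorspace K "V \<T>" using vectorspace top(1) .
  have lin: "linear_map K (dual_space K (V G)) (dual_space K (V \<T>)) (dual_map (V \<T>) (tr \<T> G))"
    if "G \<in> P" for G
    using linear_map_dual_map trace_linear top that by blast
  obtain G where G: "G \<in> P" "w G \<noteq> ?Z" and max: "\<And>H. H \<in> P \<Longrightarrow> G < H \<Longrightarrow> w H = ?Z"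
    using finite_has_maximal[of "{H \<in> P. w H \<noteq> ?Z}"] fin \<open>F \<in> P\<close> \<open>w F \<noteq> ?Z\<close>
    by (auto simp: less_le)
  have "\<forall>H\<in>P. \<exists>\<beta>\<in>D H. w H = dual_map (V \<T>) (tr \<T> H) \<beta>" using w by (auto simp: Pi_iff)
  then obtain \<beta> where \<beta>: "\<And>H. H \<in> P \<Longrightarrow> \<beta> H \<in> D H"
    "\<And>H. H \<in> P \<Longrightarrow> w H = dual_map (V \<T>) (tr \<T> H) (\<beta> H)" by metis
  have \<beta>c: "\<beta> H \<in> carrier (dual_space K (V H))" if "H \<in> P" for H
    using \<beta>(1) D that by blast
  have wc: "w \<in> P \<rightarrow> carrier (dual_space K (V \<T>))"
    using \<beta>(2) \<beta>c linear_map.T_im[OF lin] by simp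
  have "\<beta> G \<phi> = \<zero>\<^bsub>K\<^esub>" if \<phi>: "\<phi> \<in> U G" for \<phi>
  proof -
    have e: "E \<T> G \<phi> \<in> carrier (V \<T>)" using ext_closed top(1) G(1) \<phi> .
    have \<phi>c: "\<phi> \<in> carrier (V G)" using \<phi> by (simp add: vanishing_trace_def)
    have val: "w H (E \<T> G \<phi>) = (if G = H then \<beta> G \<phi> else \<zero>\<^bsub>K\<^esub>)" if H: "H \<in> P" for H
    proof -
      consider "H = G" | "G < H" | "\<not> G \<le> H" by (auto simp: less_le)
      then show ?thesis
      proof cases
        case 1
        then show ?thesis
          using \<beta>(2) dual_trace_apply_ext[OF top(1) H G(1) top(2)[OF H] \<phi>] ext_refl \<phi> H by simp
      next
        case 2
        then show ?thesis using max[OF H] e field by auto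
      next
        case 3
        then have "w H (E \<T> G \<phi>) = \<beta> H \<zero>\<^bsub>V H\<^esub>"
          using \<beta>(2)[OF H] dual_trace_apply_ext[OF top(1) H G(1) top(2)[OF H] \<phi>]
            ext_zero[OF H G(1) _ \<phi>] by simp
        then show ?thesis
          using functional_zero[OF vectorspace[OF H] \<beta>c[OF H]] 3 by auto
      qed
    qed
    have "\<beta> G \<phi> = (\<Oplus>\<^bsub>K\<^esub>H\<in>P. if G = H then \<beta> G \<phi> else \<zero>\<^bsub>K\<^esub>)"
      using VT.R.finsum_singleton[OF G(1) fin, of "\<lambda>_. \<beta> G \<phi>"] dual_spaceD(2)[OF \<beta>c[OF G(1)] \<phi>c]
      by simp
    also have "\<dots> = (\<Oplus>\<^bsub>K\<^esub>H\<in>P. w H (E \<T> G \<phi>))"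
      using dual_spaceD(2)[OF \<beta>c[OF G(1)] \<phi>c]
      by (intro VT.R.finsum_cong') (use val wc e in \<open>auto simp: Pi_iff intro: dual_spaceD(2)\<close>)
    also have "\<dots> = \<zero>\<^bsub>K\<^esub>"
      using dual_space_finsum_apply[OF VT.vectorspace_axioms wc e fin] sum0 e field by simp
    finally show ?thesis .
  qed
  then have "\<beta> G = \<zero>\<^bsub>dual_space K (V G)\<^esub>" using inj G(1) \<beta>(1) by blast
  then have "w G = ?Z" using \<beta>(2)[OF G(1)] linear_map.T0_is_0[OF lin[OF G(1)]] by simp
  then show False using G(2) by simp
qed

text \<open>The induction goes from the top downwards and splits off one summand of \<open>\<alpha>\<close> at a time; the
  remainder \<open>\<gamma>\<close> vanishes on the extensions from all elements visited so far.\<close>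

lemma dual_trace_images_span:
  assumes fin: "finite P" and top: "\<T> \<in> P" "\<And>F. F \<in> P \<Longrightarrow> F \<le> \<T>"
    and D: "\<And>F. F \<in> P \<Longrightarrow> D F \<subseteq> carrier (dual_space K (V F))"
    and surj: "\<And>F \<alpha>. F \<in> P \<Longrightarrow> \<alpha> \<in> carrier (dual_space K ((V F)\<lparr>carrier := U F\<rparr>)) \<Longrightarrow>
      \<exists>\<beta>\<in>D F. \<forall>\<phi>\<in>U F. \<beta> \<phi> = \<alpha> \<phi>"
    and \<alpha>: "\<alpha> \<in> carrier (dual_space K (V \<T>))"
  shows "\<exists>w \<in> \<Pi>\<^sub>E F\<in>P. dual_map (V \<T>) (tr \<T> F) ` D F. \<alpha> = (\<Oplus>\<^bsub>dual_space K (V \<T>)\<^esub>F\<in>P. w F)"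
proof -
  let ?X = "dual_space K (V \<T>)" and ?W = "\<lambda>F. dual_map (V \<T>) (tr \<T> F) ` D F"
  interpret VT: vectorspace K "V \<T>" using vectorspace top(1) .
  interpret X: vectorspace K ?X using VT.vectorspace_axioms by (rule vectorspace_dual_space)
  have WX: "?W F \<subseteq> carrier ?X" if "F \<in> P" for F
    using linear_map.T_im[OF linear_map_dual_map[OF trace_linear[OF top(1) that top(2)[OF that]]]] D[OF that]
    by blast
  have as: "asymp_on P (>)" "transp_on P (>)"
    by (auto intro: asymp_onI transp_onI)
  \<comment> \<open>The invariant is named because \<open>P\<close> also occurs in \<open>U F\<close>, where the induction must leave it
    alone.\<close>
  define Q where "Q A \<longleftrightarrow> (\<exists>w \<in> \<Pi>\<^sub>E F\<in>A. ?W F. \<exists>\<gamma>\<in>carrier ?X.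
      \<alpha> = \<gamma> \<oplus>\<^bsub>?X\<^esub> (\<Oplus>\<^bsub>?X\<^esub>F\<in>A. w F) \<and> (\<forall>F\<in>A. \<forall>\<phi>\<in>U F. \<gamma> (E \<T> F \<phi>) = \<zero>\<^bsub>K\<^esub>))" for A
  have "Q P"
    using fin as
  proof (induction rule: finite_closed_set_induct)
    case empty
    show ?case unfolding Q_def using \<alpha> X.M.r_zero[OF \<alpha>]
      by (intro bexI[of _ "\<lambda>_. undefined"] bexI[of _ \<alpha>]) (simp_all del: dual_space_simps)
  next
    case (insert A G)
    then obtain w \<gamma> where w: "w \<in> (\<Pi>\<^sub>E F\<in>A. ?W F)" and \<gamma>: "\<gamma> \<in> carrier ?X"
      and \<alpha>_eq: "\<alpha> = \<gamma> \<oplus>\<^bsub>?X\<^esub> (\<Oplus>\<^bsub>?X\<^esub>F\<in>A. w F)"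
      and van: "\<And>F \<phi>. F \<in> A \<Longrightarrow> \<phi> \<in> U F \<Longrightarrow> \<gamma> (E \<T> F \<phi>) = \<zero>\<^bsub>K\<^esub>"
      unfolding Q_def by blast
    have G: "G \<in> P" "G \<notin> A" using insert.hyps(2) by auto
    \<comment> \<open>The functional to be matched is \<open>\<gamma>\<close> pulled back along \<open>E \<T> G\<close>.\<close>
    obtain \<beta> where \<beta>: "\<beta> \<in> D G" and \<beta>_eq: "\<And>\<phi>. \<phi> \<in> U G \<Longrightarrow> \<beta> \<phi> = \<gamma> (E \<T> G \<phi>)"
      using surj[OF G(1) linear_map.T_im[OF linear_map_dual_map[OF ext_linear[OF top(1) G(1)]] \<gamma>]]
      by (auto simp: dual_map_def)
    define \<beta>' where "\<beta>' = dual_map (V \<T>) (tr \<T> G) \<beta>"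
    define \<gamma>' where "\<gamma>' = \<gamma> \<ominus>\<^bsub>?X\<^esub> \<beta>'"
    define w' where "w' = w(G := \<beta>')"
    have \<beta>': "\<beta>' \<in> ?W G" "\<beta>' \<in> carrier ?X" using \<beta> WX[OF G(1)] by (auto simp: \<beta>'_def)
    have \<gamma>': "\<gamma>' \<in> carrier ?X" unfolding \<gamma>'_def using \<gamma> \<beta>'(2) by (rule X.M.minus_closed)
    have \<gamma>_eq: "\<gamma> = \<gamma>' \<oplus>\<^bsub>?X\<^esub> \<beta>'"
      unfolding \<gamma>'_def using \<gamma> \<beta>'(2) by (simp add: a_minus_def X.M.a_assoc X.M.l_neg del: dual_space_simps)
    have wc: "w \<in> A \<rightarrow> carrier ?X" using w WX insert.hyps(1) by (fastforce simp: PiE_iff)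
    have sum: "(\<Oplus>\<^bsub>?X\<^esub>F\<in>insert G A. w' F) = \<beta>' \<oplus>\<^bsub>?X\<^esub> (\<Oplus>\<^bsub>?X\<^esub>F\<in>A. w F)"
    proof -
      have "(\<Oplus>\<^bsub>?X\<^esub>F\<in>A. w' F) = (\<Oplus>\<^bsub>?X\<^esub>F\<in>A. w F)"
        using wc G(2) by (intro X.M.finsum_cong') (auto simp: w'_def)
      moreover have "w' \<in> A \<rightarrow> carrier ?X" "w' G = \<beta>'"
        using wc G(2) by (auto simp: w'_def)
      ultimately show ?thesis
        using X.M.finsum_insert[OF finite_subset[OF insert.hyps(1) fin] G(2), of w'] \<beta>'(2)
        by simp
    qed
    have "w' \<in> (\<Pi>\<^sub>E F\<in>insert G A. ?W F)"
      using w \<beta>'(1) unfolding w'_def by (rule PiE_fun_upd[rotated])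
    moreover have "\<alpha> = \<gamma>' \<oplus>\<^bsub>?X\<^esub> (\<Oplus>\<^bsub>?X\<^esub>F\<in>insert G A. w' F)"
      unfolding sum \<alpha>_eq
      using X.M.a_assoc[OF \<gamma>' \<beta>'(2) X.M.finsum_closed[OF wc]] \<gamma>_eq by simp
    moreover have "\<gamma>' (E \<T> F \<phi>) = \<zero>\<^bsub>K\<^esub>" if F: "F \<in> insert G A" and \<phi>: "\<phi> \<in> U F" for F \<phi>
    proof -
      have FP: "F \<in> P" using F G insert.hyps(1) by auto
      have e: "E \<T> F \<phi> \<in> carrier (V \<T>)" using ext_closed top(1) FP \<phi> .
      have ap: "\<beta>' (E \<T> F \<phi>) = \<beta> (E G F \<phi>)"
        unfolding \<beta>'_def using dual_trace_apply_ext top(1) G(1) FP top(2)[OF G(1)] \<phi> .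
      \<comment> \<open>At \<open>G\<close> both sides agree by the choice of \<open>\<beta>\<close>; at the elements visited before both are zero.\<close>
      have eq: "\<beta>' (E \<T> F \<phi>) = \<gamma> (E \<T> F \<phi>)"
      proof (cases "F = G")
        case True
        then show ?thesis using ap ext_refl[OF G(1)] \<phi> \<beta>_eq by simp
      next
        case False
        then have FA: "F \<in> A" using F by simp
        then have "\<not> F \<le> G" using insert.hyps(4)[OF FA] False by auto
        then have "\<beta>' (E \<T> F \<phi>) = \<beta> \<zero>\<^bsub>V G\<^esub>" using ap ext_zero[OF G(1) FP _ \<phi>] by simp
        also have "\<dots> = \<zero>\<^bsub>K\<^esub>"
          using functional_zero[OF vectorspace[OF G(1)]] \<beta> D[OF G(1)] by blast
        finally show ?thesis using van[OF FA \<phi>] by simp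
      qed
      have "\<gamma> (E \<T> F \<phi>) = \<gamma>' (E \<T> F \<phi>) \<oplus>\<^bsub>K\<^esub> \<beta>' (E \<T> F \<phi>)"
        using fun_cong[OF \<gamma>_eq, of "E \<T> F \<phi>"] e field by simp
      then show ?thesis
        using eq dual_spaceD(2)[OF \<gamma>' e] dual_spaceD(2)[OF \<gamma> e]
        by (metis VT.R.add.r_cancel_one')
    qed
    ultimately show ?case unfolding Q_def using \<gamma>' by blast
  qed
  then obtain w \<gamma> where w: "w \<in> (\<Pi>\<^sub>E F\<in>P. ?W F)" and \<gamma>: "\<gamma> \<in> carrier ?X"
    and \<alpha>_eq: "\<alpha> = \<gamma> \<oplus>\<^bsub>?X\<^esub> (\<Oplus>\<^bsub>?X\<^esub>F\<in>P. w F)"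
    and van: "\<And>F \<phi>. F \<in> P \<Longrightarrow> \<phi> \<in> U F \<Longrightarrow> \<gamma> (E \<T> F \<phi>) = \<zero>\<^bsub>K\<^esub>"
      unfolding Q_def by blast
  have "\<gamma> = \<zero>\<^bsub>?X\<^esub>"
    using functional_eq_zero_if_vanishes_on_extensions[OF fin top \<gamma> van] .
  moreover have "w \<in> P \<rightarrow> carrier ?X" using w WX by (fastforce simp: PiE_iff)
  ultimately show ?thesis
    using w \<alpha>_eq X.M.l_zero[OF X.M.finsum_closed, of w P] by (intro bexI[of _ w]) (simp_all del: dual_space_simps)
qed

end

theorem theorem2p22:
  fixes K :: "('k, 'r) ring_scheme"
    and P :: "'p::order set"
    and \<T> :: 'p
    and V :: "'p \<Rightarrow> ('k, 'v, 'm) module_scheme"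
    and tr E :: "'p \<Rightarrow> 'p \<Rightarrow> 'v \<Rightarrow> 'v"
    and D :: "'p \<Rightarrow> ('v \<Rightarrow> 'k) set"
  assumes "finite P"
    and "\<T> \<in> P" and "\<And>F. F \<in> P \<Longrightarrow> F \<le> \<T>"
    and "function_space K P V tr"
    and "\<And>F. F \<in> P \<Longrightarrow> subspace K (D F) (dual_space K (V F))"
    and "\<And>F. F \<in> P \<Longrightarrow> restricts_isomorphically K (V F) (vanishing_trace P V tr F) (D F)"
    and "consistent_extension K P V tr E"
  shows "internal_direct_sum K (dual_space K (V \<T>)) P
           (\<lambda>F. dual_map (V \<T>) (tr \<T> F) ` D F)"
proof -
  interpret consistent_extension K P V tr E by fact
  have D: "D F \<subseteq> carrier (dual_space K (V F))" if "F \<in> P" for F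
    using assms(5)[OF that] submodule.subset by (auto simp only: subspace_def)
  have surj: "\<exists>\<beta>\<in>D F. \<forall>\<phi>\<in>U F. \<beta> \<phi> = \<alpha> \<phi>"
    if "F \<in> P" "\<alpha> \<in> carrier (dual_space K ((V F)\<lparr>carrier := U F\<rparr>))" for F \<alpha>
    using assms(6)[OF that(1)] that(2) by (simp only: restricts_isomorphically_def)
  have inj: "\<beta> = \<zero>\<^bsub>dual_space K (V F)\<^esub>"
    if "F \<in> P" "\<beta> \<in> D F" "\<And>\<phi>. \<phi> \<in> U F \<Longrightarrow> \<beta> \<phi> = \<zero>\<^bsub>K\<^esub>" for F \<beta>
    using assms(6)[OF that(1)] that(2,3) unfolding restricts_isomorphically_def by blast
  show ?thesis
  proof (rule internal_direct_sumI)
    show "vectorspace K (dual_space K (V \<T>))"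
      by (rule vectorspace_dual_space[OF vectorspace[OF assms(2)]])
    show "subspace K (dual_map (V \<T>) (tr \<T> F) ` D F) (dual_space K (V \<T>))" if "F \<in> P" for F
      using subspace_linear_image[OF linear_map_dual_map[OF trace_linear[OF assms(2) that assms(3)[OF that]]]
          assms(5)[OF that]] .
  next
    fix \<alpha> assume "\<alpha> \<in> carrier (dual_space K (V \<T>))"
    then show "\<exists>w \<in> \<Pi>\<^sub>E F\<in>P. dual_map (V \<T>) (tr \<T> F) ` D F.
        \<alpha> = (\<Oplus>\<^bsub>dual_space K (V \<T>)\<^esub>F\<in>P. w F)"
      using dual_trace_images_span[OF assms(1-3) D surj] by blast
  next
    fix w F
    assume "w \<in> (\<Pi> F\<in>P. dual_map (V \<T>) (tr \<T> F) ` D F)" "F \<in> P"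
      and "(\<Oplus>\<^bsub>dual_space K (V \<T>)\<^esub>F\<in>P. w F) = \<zero>\<^bsub>dual_space K (V \<T>)\<^esub>"
    then show "w F = \<zero>\<^bsub>dual_space K (V \<T>)\<^esub>"
      using dual_trace_images_independent[OF assms(1-3) D inj] by blast
  qed (rule assms(1))
qed

end
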